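(* Let $\Lambda=\{\lambda_1,\lambda_2,\ldots,\lambda_n\}$ be a list of complex numbers with $\lambda_1$ real and $$\lambda_j\in\{z\in\mathbb{C}:\ \operatorname{Re}z\le 0,\ |\operatorname{Re}z|\ge|\operatorname{Im}z|\},\qquad j=2,3,\ldots,n,$$ satisfying $\lambda_{n-j+2}=\overline{\lambda_j}$ for $j=2,3,\ldots,\left\lfloor\frac{n+1}{2}\right\rfloor$. Then $\Lambda$ is the spectrum of an $n\times n$ permutative nonnegative matrix if and only if $\sum_{j=1}^n\lambda_j\ge 0$ (that is, the sum is real and nonnegative).
   Context: An $n\times n$ matrix is permutative if every one of its rows is a permutation of its first row. Nonnegative is meant entrywise. The spectrum is the list (multiset) of eigenvalues counted with algebraic multiplicity. *)

theory Defs
  imports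
    Complex_Main
    "HOL-Combinatorics.Permutations"
    "Jordan_Normal_Form.Char_Poly"
begin

definition permutative_mat :: "'a mat \<Rightarrow> bool" where
  "permutative_mat A \<longleftrightarrow> square_mat A \<and>
     (\<forall>i < dim_row A. \<exists>p. p permutes {..<dim_col A} \<and>
        (\<forall>j < dim_col A. A $$ (i, j) = A $$ (0, p j)))"

definition nonnegative_mat :: "real mat \<Rightarrow> bool" where
  "nonnegative_mat A \<longleftrightarrow> (\<forall>i < dim_row A. \<forall>j < dim_col A. 0 \<le> A $$ (i, j))"

(* The algebraic multiplicity of an eigenvalue is its order as a root of the
   characteristic polynomial, which is its multiplicity in proots. *)
definition eigenvalue_mset :: "real mat \<Rightarrow> complex multiset" where
  "eigenvalue_mset A = proots (char_poly (map_mat complex_of_real A))"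

end

theory Submission
  imports Defs "Jordan_Normal_Form.Schur_Decomposition"
begin

text \<open>
  Necessity is the trace identity. For sufficiency, index rows and eigenvalues from \<open>0\<close> and let \<open>r\<close> be the
  involution \<open>k \<mapsto> n - k\<close> that pairs conjugate eigenvalues (fixing \<open>0\<close>). Row \<open>k\<close> of the matrix is
  a vector \<open>x\<close> permuted cyclically on the positions \<open>0, k, r k\<close>. Subtracting the row vector \<open>x\<close>
  from every row leaves a matrix that annihilates the all-ones vector and is block diagonal on the
  pairs \<open>{k, r k}\<close>, with blocks that all have the eigenvectors \<open>e\<^sub>k + z e\<^bsub>r k\<^esub>\<close>, where
  \<open>z = exp (\<i> \<pi> / 3)\<close>. In the basis formed by these vectors and the all-ones vector the matrix is
  thus upper triangular. Solving for \<open>x\<close> gives \<open>x\<^sub>0 = tr / n\<close> and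
  \<open>x\<^sub>k = x\<^sub>0 - Re \<lambda>\<^sub>k + Im \<lambda>\<^sub>k / \<surd>3\<close>, which are nonnegative under the hypotheses.
\<close>

section \<open>Sum of the eigenvalues and the trace\<close>

lemma proots_prod_list_linear:
  fixes as :: "'a :: idom list"
  shows "proots (\<Prod>a\<leftarrow>as. [:- a, 1:]) = mset as"
proof (induction as)
  case (Cons a as)
  have "(\<Prod>a\<leftarrow>as. [:- a, 1:]) \<noteq> (0 :: 'a poly)"
    by (auto simp: prod_list_zero_iff)
  then show ?case
    using Cons by (simp add: proots_mult del: mult_pCons_left)
qed simp

lemma trace_mult_comm:
  fixes A B :: "'a :: comm_semiring_0 mat"
  assumes "A \<in> carrier_mat n n" "B \<in> carrier_mat n n"
  shows "(\<Sum>i<n. (A * B) $$ (i, i)) = (\<Sum>i<n. (B * A) $$ (i, i))"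
proof -
  have "(\<Sum>i<n. (A * B) $$ (i, i)) = (\<Sum>i<n. \<Sum>j<n. A $$ (i, j) * B $$ (j, i))"
    using assms by (auto simp: scalar_prod_def atLeast0LessThan intro!: sum.cong)
  also have "\<dots> = (\<Sum>j<n. \<Sum>i<n. B $$ (j, i) * A $$ (i, j))"
    by (subst sum.swap) (simp add: mult.commute)
  also have "\<dots> = (\<Sum>i<n. (B * A) $$ (i, i))"
    using assms by (auto simp: scalar_prod_def atLeast0LessThan intro!: sum.cong)
  finally show ?thesis .
qed

text \<open>Schur decomposition makes \<open>A\<close> similar to a triangular matrix whose diagonal
  lists the roots, and cyclicity of the trace carries the diagonal sum over.\<close>

lemma sum_mset_proots_char_poly:
  fixes A :: "complex mat"
  assumes A: "A \<in> carrier_mat n n"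
  shows "\<Sum>\<^sub># (proots (char_poly A)) = (\<Sum>i<n. A $$ (i, i))"
proof -
  obtain as where as: "char_poly A = (\<Prod>a\<leftarrow>as. [:- a, 1:])"
    using char_poly_factorized[OF A] by blast
  obtain B P Q where BPQ: "schur_decomposition A as = (B, P, Q)"
    by (cases "schur_decomposition A as") auto
  have sim: "similar_mat_wit A B P Q" and diag: "diag_mat B = as"
    using schur_decomposition[OF A as BPQ] by auto
  note D = similar_mat_witD2[OF A sim]
  have B: "B \<in> carrier_mat n n" and P: "P \<in> carrier_mat n n" and Q: "Q \<in> carrier_mat n n"
    using D by auto
  have "(\<Sum>i<n. A $$ (i, i)) = (\<Sum>i<n. (P * (B * Q)) $$ (i, i))"
    using D by (simp add: assoc_mult_mat[OF P B Q])
  also have "\<dots> = (\<Sum>i<n. ((B * Q) * P) $$ (i, i))"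
    using B P Q by (intro trace_mult_comm) auto
  also have "(B * Q) * P = B"
    using D by (simp add: assoc_mult_mat[OF B Q P])
  also have "(\<Sum>i<n. B $$ (i, i)) = sum_list as"
    using B diag by (auto simp: diag_mat_def sum_list_sum_nth atLeast0LessThan)
  finally show ?thesis
    using as by (simp add: proots_prod_list_linear sum_mset_sum_list)
qed

section \<open>Spectrum of the matrix attached to an involution\<close>

lemma char_poly_eq_if_intertwined:
  fixes A :: "'a :: field mat"
  assumes "A \<in> carrier_mat n n" "B \<in> carrier_mat n n" "P \<in> carrier_mat n n"
    and Q: "Q \<in> carrier_mat n n"
    and PQ: "P * Q = 1\<^sub>m n" and AP: "A * P = P * B"
  shows "char_poly A = char_poly B"
proof (rule char_poly_similar, rule similar_matI)
  show "{A, B, P, Q} \<subseteq> carrier_mat n n" using assms by auto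
  show "P * Q = 1\<^sub>m n" by fact
  show "Q * P = 1\<^sub>m n"
    using assms(3) Q PQ by (rule mat_mult_left_right_inverse)
  have "P * B * Q = A * (P * Q)"
    using assms by (simp flip: AP)
  then show "A = P * B * Q" using PQ assms by simp
qed

definition sixth_root :: complex where
  "sixth_root = Complex (1/2) (sqrt 3 / 2)"

text \<open>This relation makes both coordinates of \<open>e_k + z e_(r k)\<close> scale by the same
  factor under the block, whatever \<open>x\<close> is.\<close>

lemma sixth_root_square: "sixth_root * sixth_root = sixth_root - 1"
  by (simp add: sixth_root_def complex_eq_iff)

lemma one_plus_sixth_root_neq_0: "1 + sixth_root \<noteq> 0"
  and one_minus_sixth_root_neq_0: "1 - sixth_root \<noteq> 0"
  by (simp_all add: sixth_root_def complex_eq_iff)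

text \<open>When 0, \<open>k\<close> and \<open>r k\<close> are distinct, row \<open>k\<close> has
  \<open>x (r k)\<close> in column 0, \<open>x 0\<close> on the diagonal and \<open>x k\<close> in
  column \<open>r k\<close>. The product of transpositions degenerates to a swap if
  \<open>r k = k \<noteq> 0\<close>, and to the identity in row 0 if \<open>r 0 = 0\<close>.\<close>

definition involution_mat :: "nat \<Rightarrow> (nat \<Rightarrow> nat) \<Rightarrow> (nat \<Rightarrow> 'a) \<Rightarrow> 'a mat" where
  "involution_mat n r x = mat n n (\<lambda>(k, j). x (transpose k (r k) (transpose 0 k j)))"

lemma involution_mat_carrier [simp]: "involution_mat n r x \<in> carrier_mat n n"
  by (simp add: involution_mat_def)

lemma permutative_involution_mat:
  assumes r: "\<And>k. k < n \<Longrightarrow> r k < n" and r0: "r 0 = 0"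
  shows "permutative_mat (involution_mat n r x)"
  unfolding permutative_mat_def
proof (intro conjI allI impI)
  show "square_mat (involution_mat n r x)"
    by (simp add: involution_mat_def)
  fix i assume "i < dim_row (involution_mat n r x)"
  then have i: "i < n" by (simp add: involution_mat_def)
  let ?p = "transpose i (r i) \<circ> transpose 0 i"
  have p: "?p permutes {..<n}"
    using i r[OF i] by (intro permutes_compose permutes_swap_id) auto
  then have "?p j < n" if "j < n" for j
    using that permutes_in_image[OF p, of j] by simp
  then have "\<forall>j<n. involution_mat n r x $$ (i, j) = involution_mat n r x $$ (0, ?p j)"
    using i r0 by (auto simp: involution_mat_def)
  then show "\<exists>p. p permutes {..<dim_col (involution_mat n r x)} \<and>
      (\<forall>j<dim_col (involution_mat n r x).
        involution_mat n r x $$ (i, j) = involution_mat n r x $$ (0, p j))"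
    using p by (intro exI[of _ ?p]) (simp add: involution_mat_def)
qed

text \<open>After subtraction of \<open>x\<close>, row \<open>k\<close> has \<open>x 0 - x k\<close>
  in column \<open>k\<close> and, if \<open>r k \<noteq> k\<close>, also
  \<open>x k - x (r k)\<close> in column \<open>r k\<close>. Its product with the eigenvector is
  \<open>\<mu> k\<close>.\<close>

lemma eigenvalues_involution_mat:
  fixes x :: "nat \<Rightarrow> complex"
  assumes n: "n > 0" and r: "\<And>k. k < n \<Longrightarrow> r k < n" and r0: "r 0 = 0"
    and rr: "\<And>k. k < n \<Longrightarrow> r (r k) = k"
  defines "\<mu> \<equiv> \<lambda>k. if k = 0 then (\<Sum>i<n. x i)
    else x 0 + (sixth_root - 1) * x k - sixth_root * x (r k)"
  shows "proots (char_poly (involution_mat n r x)) = mset (map \<mu> [0..<n])"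
proof -
  let ?z = sixth_root
  \<comment> \<open>At a fixed point of \<open>r\<close> the two indicators add up, giving the
    nonzero vector \<open>(1 + z) e_k\<close>.\<close>
  define S where "S = mat n n (\<lambda>(i, k). if k = 0 then 1 else
    of_bool (i = k) + ?z * of_bool (i = r k))"
  \<comment> \<open>The subtracted rank-one part sends column \<open>k > 0\<close> of
    \<open>S\<close> to \<open>x k + z * x (r k)\<close> times the all-ones vector, hence row 0 of
    \<open>T\<close>.\<close>
  define T where "T = mat n n (\<lambda>(i, k). if k = 0 then of_bool (i = 0) * \<mu> 0 else
    of_bool (i = 0) * (x k + ?z * x (r k)) + of_bool (i = k) * \<mu> k)"
  \<comment> \<open>With \<open>s_k\<close> the columns of \<open>S\<close> and
    \<open>k > 0\<close>: \<open>s_k - z s_(r k) = (1 - z^2) e_k\<close>, and the \<open>s_k\<close>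
    sum to \<open>1 + z\<close> times the all-ones vector minus \<open>e_0\<close>.\<close>
  define Q where "Q = mat n n (\<lambda>(i, k).
    if k = 0 then of_bool (i = 0) - of_bool (i \<noteq> 0) / (1 + ?z)
    else (of_bool (i = k) - ?z * of_bool (i = r k)) / ((1 + ?z) * (1 - ?z)))"
  let ?A = "involution_mat n r x"
  have carr: "S \<in> carrier_mat n n" "T \<in> carrier_mat n n" "Q \<in> carrier_mat n n"
    by (auto simp: S_def T_def Q_def)
  have prod: "(X * Y) $$ (i, k) = (\<Sum>l<n. X $$ (i, l) * Y $$ (l, k))"
    if "X \<in> carrier_mat n n" "Y \<in> carrier_mat n n" "i < n" "k < n" for X Y :: "complex mat" and i k
    using that by (auto simp: scalar_prod_def atLeast0LessThan intro!: sum.cong)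
  have r_eq: "i = r l \<longleftrightarrow> l = r i" if "i < n" "l < n" for i l
    using that rr by metis
  have r_pos: "r k > 0" if "k < n" "k > 0" for k
    using that rr r0 by (metis gr0I)
  have S0: "S $$ (i, 0) = 1" if "i < n" for i
    using that n by (simp add: S_def)
  have mult_S: "(\<Sum>l<n. f l * S $$ (l, k)) = f k + ?z * f (r k)"
    if k: "0 < k" "k < n" for f k
  proof -
    have "(\<Sum>l<n. f l * S $$ (l, k)) =
        (\<Sum>l<n. (if l = k then f l else 0) + (if l = r k then ?z * f l else 0))"
      using k by (intro sum.cong) (auto simp: S_def algebra_simps)
    then show ?thesis using k r by (simp add: sum.distrib)
  qed
  have "S * Q = 1\<^sub>m n"
  \<comment> \<open>\<open>Q * S\<close> is the convenient side: \<open>S0\<close> and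
    \<open>mult_S\<close> evaluate any product with a column of \<open>S\<close>.\<close>
  proof (rule mat_mult_left_right_inverse)
    show "Q * S = 1\<^sub>m n"
    proof (rule eq_matI)
      fix i k assume "i < dim_row (1\<^sub>m n :: complex mat)" "k < dim_col (1\<^sub>m n :: complex mat)"
      then have i: "i < n" and k: "k < n" by auto
      have z1: "1 + ?z \<noteq> 0" and z2: "1 - ?z \<noteq> 0"
        by (fact one_plus_sixth_root_neq_0 one_minus_sixth_root_neq_0)+
      show "(Q * S) $$ (i, k) = 1\<^sub>m n $$ (i, k)"
      proof (cases "k = 0")
        case True
        have "(Q * S) $$ (i, k) = (\<Sum>l<n. Q $$ (i, l))"
          using i k carr True by (simp add: prod S0 del: index_mult_mat)
        also have "\<dots> = of_bool (i = 0)"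
        proof (cases "i = 0")
          case True
          have "Q $$ (i, l) = (if l = 0 then 1 else 0)" if "l < n" for l
            using that n True r_pos[of l] by (simp add: Q_def)
          then show ?thesis using n True by simp
        next
          case False
          have ri: "r i < n" "r i > 0" using i False r r_pos by auto
          \<comment> \<open>Row \<open>i\<close> of \<open>Q\<close> is supported on columns 0,
            \<open>i\<close> and \<open>r i\<close>; separate summands also cover
            \<open>r i = i\<close>.\<close>
          have "Q $$ (i, l) = (if l = 0 then - 1 / (1 + ?z) else 0)
              + (if l = i then 1 / ((1 + ?z) * (1 - ?z)) else 0)
              - (if l = r i then ?z / ((1 + ?z) * (1 - ?z)) else 0)" if l: "l < n" for l
          proof (cases "l = 0")
            case True
            then show ?thesis using i n False ri by (simp add: Q_def)
          next
            case l0: False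
            have "Q $$ (i, l) = (of_bool (l = i) - ?z * of_bool (l = r i)) / ((1 + ?z) * (1 - ?z))"
              using i l l0 by (simp add: Q_def r_eq[OF i l] eq_commute[of i l])
            then show ?thesis using l0 by (simp add: diff_divide_distrib)
          qed
          then have "(\<Sum>l<n. Q $$ (i, l)) = - 1 / (1 + ?z) + 1 / ((1 + ?z) * (1 - ?z))
              - ?z / ((1 + ?z) * (1 - ?z))"
            using i n ri by (simp add: sum.distrib sum_subtractf)
          also have "\<dots> = 0"
          proof -
            have "- 1 / a + 1 / (a * b) - (1 - b) / (a * b) = 0" if "a \<noteq> 0" "b \<noteq> 0" for a b :: complex
              using that by (simp add: divide_simps)
            from this[OF z1 z2] show ?thesis by simp
          qed
          finally show ?thesis using False by simp
        qed
        finally show ?thesis using i k True by simp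
      next
        case False
        have "(Q * S) $$ (i, k) = Q $$ (i, k) + ?z * Q $$ (i, r k)"
          using i k carr False by (simp add: prod mult_S del: index_mult_mat)
        also have "\<dots> = (of_bool (i = k) - ?z * of_bool (i = r k)
            + ?z * (of_bool (i = r k) - ?z * of_bool (i = k))) / ((1 + ?z) * (1 - ?z))"
          using i k False r_pos[OF k] r[OF k] rr[OF k] by (simp add: Q_def add_divide_distrib)
        also have "\<dots> = of_bool (i = k) * ((1 + ?z) * (1 - ?z)) / ((1 + ?z) * (1 - ?z))"
          by (simp add: algebra_simps)
        also have "\<dots> = of_bool (i = k)"
          using z1 z2 by simp
        finally show ?thesis using i k by simp
      qed
    qed (use carr in auto)
  qed (use carr in auto)
  moreover have "?A * S = S * T"
  proof (rule eq_matI)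
    fix i k assume "i < dim_row (S * T)" "k < dim_col (S * T)"
    then have i: "i < n" and k: "k < n" using carr by auto
    show "(?A * S) $$ (i, k) = (S * T) $$ (i, k)"
    proof (cases "k = 0")
      case True
      \<comment> \<open>All rows rearrange \<open>x\<close>, so they have equal sums and the
        all-ones vector is an eigenvector.\<close>
      let ?p = "transpose i (r i) \<circ> transpose 0 i"
      have p: "?p permutes {..<n}"
        using i r[OF i] by (intro permutes_compose permutes_swap_id) auto
      have "(?A * S) $$ (i, k) = (\<Sum>l<n. x (?p l))"
        using i k carr True by (simp add: prod S0 del: index_mult_mat) (simp add: involution_mat_def)
      also have "\<dots> = (\<Sum>l<n. x l)"
        by (rule sum.permute[OF p, of x, symmetric, unfolded comp_def[of x]])
      also have "\<dots> = (\<Sum>l<n. if l = 0 then S $$ (i, l) * \<mu> 0 else 0)"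
        using n i by (simp add: \<mu>_def S0)
      also have "\<dots> = (\<Sum>l<n. S $$ (i, l) * T $$ (l, k))"
        using k True by (intro sum.cong) (auto simp: T_def)
      also have "\<dots> = (S * T) $$ (i, k)"
        using i k carr by (simp add: prod del: index_mult_mat)
      finally show ?thesis .
    next
      case False
      have "(S * T) $$ (i, k) = (\<Sum>l<n. S $$ (i, l) * T $$ (l, k))"
        using i k carr by (simp add: prod del: index_mult_mat)
      also have "\<dots> = (\<Sum>l<n. (if l = 0 then S $$ (i, l) * (x k + ?z * x (r k)) else 0)
          + (if l = k then S $$ (i, l) * \<mu> k else 0))"
        using k False by (intro sum.cong) (auto simp: T_def)
      also have "\<dots> = x k + ?z * x (r k) + S $$ (i, k) * \<mu> k"
        using n i k by (simp add: sum.distrib S0)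
      finally have ST: "(S * T) $$ (i, k) = x k + ?z * x (r k) + S $$ (i, k) * \<mu> k" .
      have AS: "(?A * S) $$ (i, k) = ?A $$ (i, k) + ?z * ?A $$ (i, r k)"
        using i k carr False by (simp add: prod mult_S del: index_mult_mat)
      have S_ik: "S $$ (i, k) = of_bool (i = k) + ?z * of_bool (i = r k)"
        using i k False by (simp add: S_def)
      have zz: "?z * (?z * a) = ?z * a - a" for a
        by (simp add: sixth_root_square algebra_simps flip: mult.assoc)
      have rk: "r k < n" "r k > 0" "r (r k) = k" using r r_pos rr k False by auto
      \<comment> \<open>In the last case row \<open>i\<close> agrees with \<open>x\<close> in
        columns \<open>k\<close> and \<open>r k\<close>, so only the rank-one part
        contributes.\<close>
      consider "i = k" "r k = k" | "i = k" "r k \<noteq> k" | "i = r k" "r k \<noteq> k" | "i \<noteq> k" "i \<noteq> r k"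
        by blast
      then have "?A $$ (i, k) + ?z * ?A $$ (i, r k) =
          x k + ?z * x (r k) + (of_bool (i = k) + ?z * of_bool (i = r k)) * \<mu> k"
      proof cases
        case 4
        have "?A $$ (i, k) = x k" "?A $$ (i, r k) = x (r k)"
          using 4 i k rk False rr[OF i] r0
          by (auto simp: involution_mat_def transpose_def)
        then show ?thesis using 4 by simp
      qed (use i k rk False in \<open>auto simp: \<mu>_def involution_mat_def transpose_def
             algebra_simps zz\<close>)
      then show ?thesis by (simp only: AS ST S_ik)
    qed
  qed (use carr in \<open>auto simp: involution_mat_def\<close>)
  ultimately have "char_poly ?A = char_poly T"
    using carr by (intro char_poly_eq_if_intertwined) auto
  also have "\<dots> = (\<Prod>a\<leftarrow>diag_mat T. [:- a, 1:])"
    using carr by (intro char_poly_upper_triangular) (auto simp: T_def)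
  also have "diag_mat T = map \<mu> [0..<n]"
    by (auto simp: diag_mat_def T_def)
  finally show ?thesis
    by (simp only: proots_prod_list_linear)
qed

section \<open>Realizability and the trace condition\<close>

theorem theorem3p2:
  fixes n :: nat and lam :: "nat \<Rightarrow> complex"
  assumes "n \<ge> 1"
    and "lam 1 \<in> \<real>"
    and "\<forall>j \<in> {2..n}. lam j \<in> {z. Re z \<le> 0 \<and> \<bar>Re z\<bar> \<ge> \<bar>Im z\<bar>}"
    and "\<forall>j \<in> {2..(n + 1) div 2}. lam (n - j + 2) = cnj (lam j)"
  shows "(\<exists>A \<in> carrier_mat n n. permutative_mat A \<and> nonnegative_mat A \<and>
            eigenvalue_mset A = image_mset lam (mset_set {1..n}))
         \<longleftrightarrow> (\<Sum>j = 1..n. lam j) \<in> \<real> \<and> 0 \<le> Re (\<Sum>j = 1..n. lam j)"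
proof
  assume "\<exists>A \<in> carrier_mat n n. permutative_mat A \<and> nonnegative_mat A \<and>
            eigenvalue_mset A = image_mset lam (mset_set {1..n})"
  then obtain A where A: "A \<in> carrier_mat n n" "nonnegative_mat A"
    and ev: "eigenvalue_mset A = image_mset lam (mset_set {1..n})" by blast
  have "(\<Sum>j = 1..n. lam j) = \<Sum>\<^sub># (eigenvalue_mset A)"
    by (simp add: ev sum_unfold_sum_mset)
  also have "\<dots> = (\<Sum>i<n. map_mat complex_of_real A $$ (i, i))"
    unfolding eigenvalue_mset_def using A by (intro sum_mset_proots_char_poly) auto
  also have "\<dots> = complex_of_real (\<Sum>i<n. A $$ (i, i))"
    using A by simp
  finally have "(\<Sum>j = 1..n. lam j) = complex_of_real (\<Sum>i<n. A $$ (i, i))" .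
  moreover have "(\<Sum>i<n. A $$ (i, i)) \<ge> 0"
    using A by (intro sum_nonneg) (auto simp: nonnegative_mat_def)
  ultimately show "(\<Sum>j = 1..n. lam j) \<in> \<real> \<and> 0 \<le> Re (\<Sum>j = 1..n. lam j)"
    by (metis Reals_of_real Re_complex_of_real)
next
  assume tr: "(\<Sum>j = 1..n. lam j) \<in> \<real> \<and> 0 \<le> Re (\<Sum>j = 1..n. lam j)"
  define \<nu> where "\<nu> k = lam (Suc k)" for k
  \<comment> \<open>For \<open>j = Suc k\<close> the conjugate index \<open>n - j + 2\<close> is
    \<open>Suc (n - k)\<close>; \<open>mod\<close> keeps 0 fixed.\<close>
  define r where "r k = (n - k) mod n" for k
  \<comment> \<open>Every diagonal entry of the matrix is \<open>x 0\<close>, so the trace forces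
    this value.\<close>
  define u where "u = Re (\<Sum>j = 1..n. lam j) / n"
  \<comment> \<open>The eigenvalue for \<open>k > 0\<close> has real part
    \<open>u - (x k + x (r k)) / 2\<close> and imaginary part
    \<open>sqrt 3 / 2 * (x k - x (r k))\<close>; solve for the sum and the difference.\<close>
  define x where "x k = (if k = 0 then u else u - Re (\<nu> k) + Im (\<nu> k) / sqrt 3)" for k
  have n: "n > 0" using assms(1) by simp
  have sum_eq: "(\<Sum>j = 1..n. lam j) = (\<Sum>k<n. \<nu> k)"
    unfolding \<nu>_def by (simp add: sum.atLeast1_atMost_eq)
  have r_eq: "r k = n - k" if "0 < k" "k < n" for k
    using that by (simp add: r_def)
  have conj_low: "\<nu> (n - k) = cnj (\<nu> k)" if "0 < k" "2 * k < n" for k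
  proof -
    have "Suc k \<in> {2..(n + 1) div 2}" using that by auto
    then have "lam (n - Suc k + 2) = cnj (lam (Suc k))" using assms(4) by blast
    moreover have "n - Suc k + 2 = Suc (n - k)" using that by simp
    ultimately show ?thesis by (simp add: \<nu>_def)
  qed
  have conj_high: "\<nu> (n - k) = cnj (\<nu> k)" if "k < n" "n < 2 * k" for k
    using conj_low[of "n - k"] that by simp
  have split_0: "(\<Sum>k<n. f k) = f 0 + (\<Sum>k=1..<n. f k)" for f :: "nat \<Rightarrow> real"
    using n by (simp add: sum.atLeast_Suc_lessThan lessThan_atLeast0)
  have "Im (\<nu> 0) = 0"
    using assms(2) by (simp add: \<nu>_def complex_is_Real_iff)
  then have Im_sum: "(\<Sum>k=1..<n. Im (\<nu> k)) = 0"
    using tr unfolding sum_eq complex_is_Real_iff by (simp add: split_0)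
  text \<open>The hypotheses leave the middle entry of a list of even length free; only the
    reality of the sum makes it real.\<close>
  have conj_mid: "\<nu> (n - k) = cnj (\<nu> k)" if k: "n = 2 * k" for k
  proof -
    have "(\<Sum>j=1..<n. Im (\<nu> j)) = (\<Sum>j=1..<n. if j = k then Im (\<nu> k) else 0)
        + (\<Sum>j\<in>{1..<n} - {k}. Im (\<nu> j))"
      using n k sum.remove[of "{1..<n}" k "\<lambda>j. Im (\<nu> j)"] by simp
    \<comment> \<open>Reflecting \<open>j\<close> to \<open>n - j\<close> negates the imaginary
      parts, so this sum is its own negative.\<close>
    also have "(\<Sum>j\<in>{1..<n} - {k}. Im (\<nu> j)) = (\<Sum>j\<in>{1..<n} - {k}. - Im (\<nu> j))"
    proof (rule sum.reindex_bij_witness[of _ "\<lambda>j. n - j" "\<lambda>j. n - j"])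
      fix j assume "j \<in> {1..<n} - {k}"
      then have "\<nu> (n - j) = cnj (\<nu> j)"
        using conj_low[of j] conj_high[of j] k by (cases "j < k") auto
      then show "- Im (\<nu> (n - j)) = Im (\<nu> j)" by simp
    qed (use k in auto)
    then have "(\<Sum>j\<in>{1..<n} - {k}. Im (\<nu> j)) = 0" by (simp add: sum_negf)
    finally have "Im (\<nu> k) = 0" using Im_sum n k by simp
    then show ?thesis using k by (simp add: complex_eq_iff)
  qed
  have conj: "\<nu> (n - k) = cnj (\<nu> k)" if "0 < k" "k < n" for k
    using that conj_low[of k] conj_mid[of k] conj_high[of k]
    by (cases "n = 2 * k"; cases "2 * k < n") auto
  have r: "r k < n" "r (r k) = k" if "k < n" for k
    using that n by (cases "k = 0"; simp add: r_def)+
  have r0: "r 0 = 0" by (simp add: r_def)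
  \<comment> \<open>The values of \<open>x\<close> come from the trace and the eigenvalues with
    \<open>k > 0\<close>; the row sum must then be the remaining eigenvalue.\<close>
  have sum_x: "(\<Sum>k<n. x k) = Re (\<nu> 0)"
  proof -
    have "(\<Sum>k<n. x k) = u + (\<Sum>k=1..<n. u - Re (\<nu> k) + Im (\<nu> k) / sqrt 3)"
      by (simp add: split_0 x_def)
    also have "(\<Sum>k=1..<n. u - Re (\<nu> k) + Im (\<nu> k) / sqrt 3) =
        (real n - 1) * u - (\<Sum>k=1..<n. Re (\<nu> k))"
      using Im_sum n
      by (simp add: sum.distrib sum_subtractf of_nat_diff flip: sum_divide_distrib)
    also have "(\<Sum>k=1..<n. Re (\<nu> k)) = real n * u - Re (\<nu> 0)"
      using n unfolding u_def sum_eq by (simp add: split_0)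
    finally show ?thesis by (simp add: algebra_simps)
  qed
  have x_nonneg: "x k \<ge> 0" if "k < n" for k
  proof (cases "k = 0")
    case True
    then show ?thesis using tr by (simp add: x_def u_def)
  next
    case False
    have u: "u \<ge> 0" using tr by (simp add: u_def)
    have "Suc k \<in> {2..n}" using that False by simp
    then have le: "Re (\<nu> k) \<le> 0" "\<bar>Im (\<nu> k)\<bar> \<le> \<bar>Re (\<nu> k)\<bar>"
      using assms(3) unfolding \<nu>_def by blast+
    \<comment> \<open>Since \<open>sqrt 3 \<ge> 1\<close>, the wedge condition lets
      \<open>- Re (\<nu> k)\<close> absorb the imaginary term.\<close>
    have "\<bar>Im (\<nu> k) / sqrt 3\<bar> \<le> \<bar>Im (\<nu> k)\<bar> / 1"
      unfolding abs_divide by (intro divide_left_mono) auto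
    then have "- (Im (\<nu> k) / sqrt 3) \<le> - Re (\<nu> k)" using le by linarith
    then show ?thesis using u False by (simp add: x_def)
  qed
  let ?A = "involution_mat n r x"
  have "eigenvalue_mset ?A = proots (char_poly (involution_mat n r (\<lambda>k. complex_of_real (x k))))"
    unfolding eigenvalue_mset_def
    by (rule arg_cong[of _ _ "\<lambda>B. proots (char_poly B)"]) (auto simp: involution_mat_def)
  also have "\<dots> = mset (map (\<lambda>k. if k = 0 then (\<Sum>i<n. complex_of_real (x i))
      else x 0 + (sixth_root - 1) * x k - sixth_root * x (r k)) [0..<n])"
    using n r r0 by (intro eigenvalues_involution_mat)
  also have "\<dots> = mset (map \<nu> [0..<n])"
  proof (intro arg_cong[of _ _ mset] map_cong refl)
    fix k assume "k \<in> set [0..<n]"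
    then have k: "k < n" by simp
    have "x 0 + (sixth_root - 1) * x k - sixth_root * x (r k) = \<nu> k" if "k > 0"
      using that k conj[OF that k]
      by (simp add: r_eq x_def sixth_root_def complex_eq_iff field_simps)
    moreover have "(\<Sum>i<n. complex_of_real (x i)) = \<nu> 0"
      using sum_x \<open>Im (\<nu> 0) = 0\<close> by (simp add: complex_eq_iff)
    ultimately show "(if k = 0 then (\<Sum>i<n. complex_of_real (x i))
      else x 0 + (sixth_root - 1) * x k - sixth_root * x (r k)) = \<nu> k" by simp
  qed
  also have "\<dots> = image_mset lam (image_mset Suc (mset_set {0..<n}))"
    by (simp add: \<nu>_def[abs_def] comp_def multiset.map_comp)
  also have "image_mset Suc (mset_set {0..<n}) = mset_set {1..n}"
    by (simp add: image_mset_mset_set image_Suc_atLeastLessThan atLeastLessThanSuc_atLeastAtMost)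
  finally have "eigenvalue_mset ?A = image_mset lam (mset_set {1..n})" .
  moreover have "nonnegative_mat ?A"
    using x_nonneg r n by (auto simp: nonnegative_mat_def involution_mat_def transpose_def)
  ultimately show "\<exists>A \<in> carrier_mat n n. permutative_mat A \<and> nonnegative_mat A \<and>
            eigenvalue_mset A = image_mset lam (mset_set {1..n})"
    using permutative_involution_mat[of n r x] r r0 by (intro bexI[of _ ?A]) auto
qed

end
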